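(* For all integers $m\geq 1$ and $n\geq 3$, \[\psi_{sq}(P_{m}\circ\overline{K_{n}})=\beta_{2}(P_{m}\circ\overline{K_{n}})=mn.\]
   Context: All graphs are finite and simple (undirected, no loops, no multiple edges). For a graph $G=(V,E)$ and $v\in V$, $N_G[v]=\{v\}\cup\{u\in V: uv\in E\}$ is the closed neighborhood of $v$. A sub-quorum coloring of $G$ is an onto partial function $f:V\rightarrow\{1,2,\ldots,\ell\}$ such that for every vertex $v\in V$, if $f(v)$ is defined, then at least half of the vertices of $N_G[v]$ at which $f$ is defined have the same color (value of $f$) as $v$. The sub-quorum coloring number $\psi_{sq}(G)$ is the maximum value of $\ell$ over all sub-quorum colorings of $G$. A set $S\subseteq V$ is a $2$-independent set of $G$ if every vertex of $S$ has at most one neighbor in $S$; the $2$-independence number $\beta_2(G)$ is the maximum cardinality of a $2$-independent set of $G$. $P_m$ is the path on $m$ vertices. The corona $P_m\circ\overline{K_n}$ (the complete $n$-tuple caterpillar) is the graph on $m(n+1)$ vertices obtained from $P_m$ by appending $n$ new leaves to each vertex of $P_m$. *)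

theory Defs
  imports "Graph_Theory.Pair_Digraph"
begin

text \<open>
  A finite simple graph is a digraph satisfying the locale \<^locale>\<open>pair_graph\<close>: finite, loop-free,
  with a symmetric arc relation \<^const>\<open>parcs\<close> and hence without parallel edges.
\<close>

definition closed_nbhd :: "'a pair_pre_digraph \<Rightarrow> 'a \<Rightarrow> 'a set" where
  "closed_nbhd G v = {v} \<union> {u \<in> pverts G. (u, v) \<in> parcs G}"

definition sub_quorum_coloring :: "'a pair_pre_digraph \<Rightarrow> nat \<Rightarrow> ('a \<rightharpoonup> nat) \<Rightarrow> bool" where
  "sub_quorum_coloring G l f \<longleftrightarrow>
     dom f \<subseteq> pverts G \<and> ran f = {1..l} \<and>
     (\<forall>v \<in> dom f. 2 * card {u \<in> closed_nbhd G v. f u = f v} \<ge> card (closed_nbhd G v \<inter> dom f))"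

definition sub_quorum_number :: "'a pair_pre_digraph \<Rightarrow> nat"  (\<open>\<psi>\<^sub>s\<^sub>q\<close>) where
  "\<psi>\<^sub>s\<^sub>q G = Max {l. \<exists>f. sub_quorum_coloring G l f}"

definition two_independent :: "'a pair_pre_digraph \<Rightarrow> 'a set \<Rightarrow> bool" where
  "two_independent G S \<longleftrightarrow>
     S \<subseteq> pverts G \<and> (\<forall>v \<in> S. card {u \<in> S. (u, v) \<in> parcs G} \<le> 1)"

definition two_independence_number :: "'a pair_pre_digraph \<Rightarrow> nat"  (\<open>\<beta>\<^sub>2\<close>) where
  "\<beta>\<^sub>2 G = Max {card S |S. two_independent G S}"

text \<open>Both maxima range over finite nonempty sets.\<close>

lemma sub_quorum_values:
  assumes "pair_graph G"
  shows "finite {l. \<exists>f. sub_quorum_coloring G l f}" "{l. \<exists>f. sub_quorum_coloring G l f} \<noteq> {}"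
proof -
  interpret pair_graph G by fact
  have "l \<le> card (pverts G)" if "sub_quorum_coloring G l f" for l f
  proof -
    have d: "dom f \<subseteq> pverts G" and r: "ran f = {1..l}"
      using that by (auto simp: sub_quorum_coloring_def)
    have fin: "finite (dom f)" using d pair_finite_verts by (rule finite_subset)
    have "ran f = (\<lambda>x. the (f x)) ` dom f" by (force simp: ran_def dom_def image_iff)
    then have "card (ran f) \<le> card (dom f)" using card_image_le[OF fin] by simp
    then have "l \<le> card (dom f)" using r by simp
    also have "\<dots> \<le> card (pverts G)" using d pair_finite_verts by (rule card_mono[rotated])
    finally show ?thesis .
  qed
  then have "{l. \<exists>f. sub_quorum_coloring G l f} \<subseteq> {..card (pverts G)}" by auto
  then show "finite {l. \<exists>f. sub_quorum_coloring G l f}" by (rule finite_subset) simp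
  have "sub_quorum_coloring G 0 Map.empty" by (simp add: sub_quorum_coloring_def)
  then show "{l. \<exists>f. sub_quorum_coloring G l f} \<noteq> {}" by blast
qed

lemma two_independent_values:
  assumes "pair_graph G"
  shows "finite {card S |S. two_independent G S}" "{card S |S. two_independent G S} \<noteq> {}"
proof -
  interpret pair_graph G by fact
  have "{card S |S. two_independent G S} \<subseteq> card ` Pow (pverts G)"
    by (auto simp: two_independent_def)
  then show "finite {card S |S. two_independent G S}"
    using pair_finite_verts by (meson finite_Pow_iff finite_imageI finite_subset)
  have "two_independent G {}" by (simp add: two_independent_def)
  then show "{card S |S. two_independent G S} \<noteq> {}" by blast
qed

definition path_graph :: "nat \<Rightarrow> nat pair_pre_digraph" where
  "path_graph m = \<lparr>pverts = {..<m}, parcs = {(i, j). i < m \<and> j < m \<and> (j = Suc i \<or> i = Suc j)}\<rparr>"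

definition edgeless_graph :: "nat \<Rightarrow> nat pair_pre_digraph" where
  "edgeless_graph n = \<lparr>pverts = {..<n}, parcs = {}\<rparr>"

text \<open>
  \<open>corona G H\<close> has the vertices \<open>Inl v\<close> of \<open>G\<close> and, for each \<open>v\<close>, a copy of \<open>H\<close> with vertices
  \<open>Inr (v, x)\<close>, all of which are joined to \<open>Inl v\<close>.
\<close>

definition corona ::
  "'a pair_pre_digraph \<Rightarrow> 'b pair_pre_digraph \<Rightarrow> ('a + 'a \<times> 'b) pair_pre_digraph" where
  "corona G H = \<lparr>
     pverts = Inl ` pverts G \<union> Inr ` (pverts G \<times> pverts H),
     parcs = {(Inl u, Inl v) |u v. (u, v) \<in> parcs G}
       \<union> {(Inr (v, x), Inr (v, y)) |v x y. v \<in> pverts G \<and> (x, y) \<in> parcs H}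
       \<union> {(Inl v, Inr (v, x)) |v x. v \<in> pverts G \<and> x \<in> pverts H}
       \<union> {(Inr (v, x), Inl v) |v x. v \<in> pverts G \<and> x \<in> pverts H}\<rparr>"

lemma pair_graphI:
  assumes "finite (pverts G)" "parcs G \<subseteq> pverts G \<times> pverts G" "sym (parcs G)" "irrefl (parcs G)"
  shows "pair_graph G"
  using assms
  by unfold_locales
    (auto simp: symmetric_def irrefl_def intro: finite_subset[OF assms(2)])

lemma pair_graph_path_graph: "pair_graph (path_graph m)"
  by (rule pair_graphI) (auto simp: path_graph_def sym_def irrefl_def)

lemma pair_graph_edgeless_graph: "pair_graph (edgeless_graph n)"
  by (rule pair_graphI) (auto simp: edgeless_graph_def sym_def irrefl_def)

lemma pair_graph_corona:
  assumes "pair_graph G" "pair_graph H"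
  shows "pair_graph (corona G H)"
proof -
  interpret G: pair_graph G by fact
  interpret H: pair_graph H by fact
  show ?thesis
  proof (rule pair_graphI)
    show "finite (pverts (corona G H))"
      by (simp add: corona_def G.pair_finite_verts H.pair_finite_verts)
    show "parcs (corona G H) \<subseteq> pverts (corona G H) \<times> pverts (corona G H)"
      by (auto simp: corona_def dest: G.wellformed' H.wellformed')
    show "sym (parcs (corona G H))"
      by (auto simp: corona_def sym_def dest: G.arcs_symmetric H.arcs_symmetric)
    show "irrefl (parcs (corona G H))"
      by (auto simp: corona_def irrefl_def dest: G.no_loops' H.no_loops')
  qed
qed

lemma card_pverts_caterpillar:
  "card (pverts (corona (path_graph m) (edgeless_graph n))) = m * (n + 1)"
proof -
  have "card (Inl ` {..<m} \<union> Inr ` ({..<m} \<times> {..<n}) :: (nat + nat \<times> nat) set) = m + m * n"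
    by (subst card_Un_disjoint) (auto simp: card_image card_cartesian_product)
  then show ?thesis by (simp add: corona_def path_graph_def edgeless_graph_def)
qed

end

theory Submission
  imports Defs
begin

text \<open>
  Call a path vertex together with its leaves a block. A 2-independent set containing the path
  vertex of a block contains at most one of its leaves, so it has at most \<open>n\<close> vertices in each block.
  In a sub-quorum coloring, each block has at most \<open>n\<close> colors that do not occur in the preceding
  blocks: otherwise its \<open>n + 1\<close> vertices have distinct new colors, and the path vertex shares its
  color with the next path vertex at most, which is not a sub-quorum. Both bounds \<open>m n\<close> are
  attained on the set of all leaves.
\<close>

abbreviation caterpillar :: "nat \<Rightarrow> nat \<Rightarrow> (nat + nat \<times> nat) pair_pre_digraph" where
  "caterpillar m n \<equiv> corona (path_graph m) (edgeless_graph n)"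

definition block :: "nat \<Rightarrow> nat \<Rightarrow> (nat + nat \<times> nat) set" where
  "block n i = insert (Inl i) (Inr ` ({i} \<times> {..<n}))"

definition leaves :: "nat \<Rightarrow> nat \<Rightarrow> (nat + nat \<times> nat) set" where
  "leaves m n = Inr ` ({..<m} \<times> {..<n})"

lemma pair_graph_caterpillar: "pair_graph (caterpillar m n)"
  by (intro pair_graph_corona pair_graph_path_graph pair_graph_edgeless_graph)

lemma finite_block [simp]: "finite (block n i)"
  by (simp add: block_def)

lemma card_block [simp]: "card (block n i) = Suc n"
  unfolding block_def by (subst card_insert_disjoint) (auto simp: card_image card_cartesian_product)

lemma card_leaves [simp]: "card (leaves m n) = m * n"
  by (simp add: leaves_def card_image card_cartesian_product)

lemma leaves_subset_pverts: "leaves m n \<subseteq> pverts (caterpillar m n)"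
  by (auto simp: leaves_def corona_def path_graph_def edgeless_graph_def)

lemma leaves_independent:
  "u \<in> leaves m n \<Longrightarrow> v \<in> leaves m n \<Longrightarrow> (u, v) \<notin> parcs (caterpillar m n)"
  by (auto simp: leaves_def corona_def path_graph_def edgeless_graph_def)

lemma pverts_caterpillar: "pverts (caterpillar m n) = (\<Union>i<m. block n i)"
  by (auto simp: block_def corona_def path_graph_def edgeless_graph_def)

text \<open>The only neighbor of a leaf is a path vertex, so once nothing but leaves is colored, a
  leaf sees no colored vertex except itself.\<close>

lemma closed_nbhd_leaf_Int_leaves:
  "v \<in> leaves m n \<Longrightarrow> closed_nbhd (caterpillar m n) v \<inter> leaves m n = {v}"
  using leaves_independent by (fastforce simp: closed_nbhd_def)

lemma block_subset_closed_nbhd: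
  "i < m \<Longrightarrow> block n i \<subseteq> closed_nbhd (caterpillar m n) (Inl i)"
  by (auto simp: block_def closed_nbhd_def corona_def path_graph_def edgeless_graph_def)

text \<open>The preceding path vertex is absorbed into the union of earlier blocks, whose colors are
  all old. This leaves \<open>Inl (Suc i)\<close> as the only outside vertex to treat separately,
  and \<open>i = 0\<close> needs no case of its own.\<close>

lemma closed_nbhd_path_vertex_subset:
  "closed_nbhd (caterpillar m n) (Inl i)
    \<subseteq> block n i \<union> {Inl (Suc i)} \<union> (\<Union>j<i. block n j)"
  by (auto simp: block_def closed_nbhd_def corona_def path_graph_def edgeless_graph_def)

lemma two_independent_leaves: "two_independent (caterpillar m n) (leaves m n)"
  unfolding two_independent_def
proof (intro conjI ballI)
  fix v assume "v \<in> leaves m n"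
  then have "{u \<in> leaves m n. (u, v) \<in> parcs (caterpillar m n)} = {}"
    using leaves_independent by blast
  then show "card {u \<in> leaves m n. (u, v) \<in> parcs (caterpillar m n)} \<le> 1"
    by (simp only: card.empty)
qed (rule leaves_subset_pverts)

lemma card_two_independent_Int_block:
  assumes S: "two_independent (caterpillar m n) S" and "i < m" "2 \<le> n"
  shows "card (S \<inter> block n i) \<le> n"
proof (cases "Inl i \<in> S")
  case True
  let ?T = "{u \<in> S. (u, Inl i) \<in> parcs (caterpillar m n)}"
  have "S \<subseteq> pverts (caterpillar m n)"
    using S by (simp add: two_independent_def)
  then have "finite S"
    by (rule finite_subset) (simp add: pverts_caterpillar)
  \<comment> \<open>All other vertices of the block are leaves adjacent to \<open>Inl i\<close>, so
    those in \<open>S\<close> are counted by \<open>?T\<close>, which has at most one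
    element.\<close>
  moreover have "S \<inter> block n i \<subseteq> insert (Inl i) ?T"
    using \<open>i < m\<close> by (auto simp: block_def corona_def path_graph_def edgeless_graph_def)
  ultimately have "card (S \<inter> block n i) \<le> card (insert (Inl i) ?T)"
    by (intro card_mono) auto
  also have "\<dots> \<le> Suc (card ?T)" using card_insert_le_m1[of "Suc (card ?T)" ?T] by simp
  also have "\<dots> \<le> 2"
    using S True by (auto simp: two_independent_def)
  finally show ?thesis using \<open>2 \<le> n\<close> by simp
next
  case False
  have centre: "Inl i \<in> block n i" by (simp add: block_def)
  from False have "S \<inter> block n i \<subseteq> block n i - {Inl i}" by blast
  then have "card (S \<inter> block n i) \<le> card (block n i - {Inl i})" by (intro card_mono) auto
  also have "\<dots> = n" using card_Diff_singleton[of "Inl i" "block n i"] by (simp add: centre)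
  finally show ?thesis .
qed

lemma card_two_independent_le:
  assumes S: "two_independent (caterpillar m n) S" and "2 \<le> n"
  shows "card S \<le> m * n"
proof -
  have "S = (\<Union>i<m. S \<inter> block n i)"
    using S by (auto simp: two_independent_def pverts_caterpillar)
  then have "card S \<le> (\<Sum>i<m. card (S \<inter> block n i))"
    by (metis card_UN_le finite_lessThan)
  also have "\<dots> \<le> (\<Sum>i<m. n)"
    using card_two_independent_Int_block[OF S _ \<open>2 \<le> n\<close>] by (intro sum_mono) auto
  finally show ?thesis by simp
qed

theorem two_independence_number_caterpillar:
  assumes "2 \<le> n"
  shows "\<beta>\<^sub>2 (caterpillar m n) = m * n"
  unfolding two_independence_number_def
proof (rule Max_eqI)
  show "finite {card S |S. two_independent (caterpillar m n) S}"
    by (rule two_independent_values[OF pair_graph_caterpillar])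
  show "m * n \<in> {card S |S. two_independent (caterpillar m n) S}"
    using two_independent_leaves[of m n] card_leaves[of m n, symmetric] by blast
qed (use card_two_independent_le[OF _ assms] in auto)

text \<open>Give the leaves pairwise distinct colors and leave the path vertices uncolored.\<close>

lemma sub_quorum_coloring_leaves:
  "\<exists>f. sub_quorum_coloring (caterpillar m n) (m * n) f"
proof -
  have "finite (leaves m n)" by (simp add: leaves_def)
  then obtain h where h: "bij_betw h (leaves m n) {1..m * n}"
    using finite_same_card_bij[of "leaves m n" "{1..m * n}"] by auto
  define f where "f = (\<lambda>v. if v \<in> leaves m n then Some (h v) else None)"
  have dom: "dom f = leaves m n" by (auto simp: f_def split: if_splits)
  have "sub_quorum_coloring (caterpillar m n) (m * n) f"
    unfolding sub_quorum_coloring_def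
  proof (intro conjI ballI)
    show "dom f \<subseteq> pverts (caterpillar m n)" using leaves_subset_pverts dom by simp
    have "ran f = h ` leaves m n" by (auto simp: f_def ran_def)
    then show "ran f = {1..m * n}" using h by (simp add: bij_betw_def)
    fix v assume v: "v \<in> dom f"
    have N: "closed_nbhd (caterpillar m n) v \<inter> dom f = {v}"
      using v closed_nbhd_leaf_Int_leaves by (simp add: dom)
    \<comment> \<open>Since \<open>f v\<close> is not \<open>None\<close>, a vertex with the same
      value is itself colored, hence lies in the intersection above.\<close>
    then have "{u \<in> closed_nbhd (caterpillar m n) v. f u = f v} = {v}"
      using v by (auto simp: dom_def)
    then show "card (closed_nbhd (caterpillar m n) v \<inter> dom f)
        \<le> 2 * card {u \<in> closed_nbhd (caterpillar m n) v. f u = f v}"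
      using N by simp
  qed
  then show ?thesis by blast
qed

text \<open>Removing \<open>None\<close> together with the old colors means that
  \<open>n + 1\<close> remaining values force the whole block to be colored, injectively and with
  new colors only.\<close>

lemma card_new_colors_block:
  assumes f: "sub_quorum_coloring (caterpillar m n) l f" and "i < m" "3 \<le> n"
  shows "card (f ` block n i - insert None (f ` (\<Union>j<i. block n j))) \<le> n"
proof (rule ccontr)
  let ?C = "insert None (f ` (\<Union>j<i. block n j))"
  let ?N = "closed_nbhd (caterpillar m n) (Inl i)"
  let ?E = "{u \<in> ?N. f u = f (Inl i)}"
  assume "\<not> ?thesis"
  then have X: "Suc n \<le> card (f ` block n i - ?C)" by simp
  have le: "card (f ` block n i) \<le> Suc n"
    using card_image_le[of "block n i" f] by simp
  \<comment> \<open>A subset with at least as many elements is the whole set, so no value on the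
    block is old or \<open>None\<close>.\<close>
  have "f ` block n i - ?C = f ` block n i"
    using X le by (intro card_seteq) auto
  then have new: "f v \<notin> ?C" if "v \<in> block n i" for v
    using that by blast
  have "card (f ` block n i) = card (block n i)"
    using le X \<open>f ` block n i - ?C = f ` block n i\<close> by simp
  then have inj: "inj_on f (block n i)"
    by (simp add: eq_card_imp_inj_on)
  have centre: "Inl i \<in> block n i" by (simp add: block_def)
  have "block n i \<subseteq> dom f" using new by auto
  then have sub: "block n i \<subseteq> ?N \<inter> dom f"
    using block_subset_closed_nbhd[OF \<open>i < m\<close>] by blast
  have "dom f \<subseteq> pverts (caterpillar m n)"
    using f by (simp add: sub_quorum_coloring_def)
  then have fin: "finite (?N \<inter> dom f)"
    by (intro finite_Int disjI2) (rule finite_subset, auto simp: pverts_caterpillar)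
  have "Inl i \<in> dom f" using centre sub by blast
  then have quorum: "card (?N \<inter> dom f) \<le> 2 * card ?E"
    using f by (auto simp: sub_quorum_coloring_def)
  \<comment> \<open>Injectivity excludes the leaves of the block, and newness of the color of
    \<open>Inl i\<close> excludes all earlier blocks.\<close>
  have E: "?E \<subseteq> {Inl i, Inl (Suc i)}"
  proof
    fix u assume u: "u \<in> ?E"
    then consider "u \<in> block n i" | "u = Inl (Suc i)" | "u \<in> (\<Union>j<i. block n j)"
      using closed_nbhd_path_vertex_subset by blast
    then show "u \<in> {Inl i, Inl (Suc i)}"
    proof cases
      case 1
      then show ?thesis using u inj centre by (auto dest: inj_onD)
    next
      case 3
      then have "f u \<in> ?C" by blast
      then show ?thesis using u new[OF centre] by simp
    qed simp
  qed
  show False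
  proof (cases "Inl (Suc i) \<in> ?E")
    case True
    \<comment> \<open>The next path vertex enlarges the color class to two, but it is also one more
      colored neighbor: the quorum would give \<open>n + 2\<close> \<le> 4, which fails from
      \<open>n = 3\<close> on.\<close>
    then have "insert (Inl (Suc i)) (block n i) \<subseteq> ?N \<inter> dom f"
      using sub \<open>Inl i \<in> dom f\<close> by (auto simp: dom_def)
    then have "card (insert (Inl (Suc i)) (block n i)) \<le> card (?N \<inter> dom f)"
      by (rule card_mono[OF fin])
    moreover have "Inl (Suc i) \<notin> block n i" by (auto simp: block_def)
    moreover have "card ?E \<le> 2"
      using card_mono[OF _ E] by simp
    ultimately show False using quorum \<open>3 \<le> n\<close> by simp
  next
    case False
    \<comment> \<open>Here the class is \<open>Inl i\<close> alone, and the quorum would give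
      \<open>n + 1\<close> \<le> 2.\<close>
    then have "?E \<subseteq> {Inl i}" using E by blast
    then have "card ?E \<le> card {Inl i :: nat + nat \<times> nat}" by (intro card_mono) simp_all
    moreover have "Suc n \<le> card (?N \<inter> dom f)"
      using card_mono[OF fin sub] by simp
    ultimately show False using quorum \<open>3 \<le> n\<close> by simp
  qed
qed

text \<open>Adding the blocks from left to right counts each color in the first block where it
  occurs.\<close>

lemma card_colors_blocks_le:
  assumes f: "sub_quorum_coloring (caterpillar m n) l f" and "3 \<le> n" "k \<le> m"
  shows "card (f ` (\<Union>i<k. block n i) - {None}) \<le> k * n"
  using \<open>k \<le> m\<close>
proof (induction k)
  case (Suc k)
  let ?A = "f ` (\<Union>i<k. block n i)"
  have "f ` (\<Union>i<Suc k. block n i) - {None} = (f ` block n k - insert None ?A) \<union> (?A - {None})"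
    by (auto simp: lessThan_Suc)
  then have "card (f ` (\<Union>i<Suc k. block n i) - {None})
      \<le> card (f ` block n k - insert None ?A) + card (?A - {None})"
    by (simp only: card_Un_le)
  also have "\<dots> \<le> n + k * n"
    using card_new_colors_block[OF f _ \<open>3 \<le> n\<close>, of k] Suc by (intro add_mono) auto
  finally show ?case by simp
qed simp

lemma sub_quorum_coloring_le:
  assumes f: "sub_quorum_coloring (caterpillar m n) l f" and "3 \<le> n"
  shows "l \<le> m * n"
proof -
  have d: "dom f \<subseteq> (\<Union>i<m. block n i)" and r: "ran f = {1..l}"
    using f by (auto simp: sub_quorum_coloring_def pverts_caterpillar)
  \<comment> \<open>Images under \<open>f\<close> consist of option values, while
    \<open>ran f\<close> consists of numbers; the injection \<open>Some\<close> carries the count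
    across.\<close>
  have "Some ` ran f \<subseteq> f ` (\<Union>i<m. block n i) - {None}"
  proof
    fix y assume "y \<in> Some ` ran f"
    then obtain v c where "f v = Some c" "y = Some c" by (auto simp: ran_def)
    moreover from this have "v \<in> (\<Union>i<m. block n i)" using d by blast
    ultimately show "y \<in> f ` (\<Union>i<m. block n i) - {None}"
      by (metis DiffI imageI option.distinct(1) singletonD)
  qed
  then have "card (Some ` ran f) \<le> card (f ` (\<Union>i<m. block n i) - {None})"
    by (rule card_mono[rotated]) simp
  also have "\<dots> \<le> m * n"
    by (rule card_colors_blocks_le[OF f \<open>3 \<le> n\<close> order_refl])
  finally show ?thesis by (simp add: card_image r)
qed

theorem sub_quorum_number_caterpillar:
  assumes "3 \<le> n"
  shows "\<psi>\<^sub>s\<^sub>q (caterpillar m n) = m * n"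
  unfolding sub_quorum_number_def
proof (rule Max_eqI)
  show "finite {l. \<exists>f. sub_quorum_coloring (caterpillar m n) l f}"
    by (rule sub_quorum_values[OF pair_graph_caterpillar])
qed (use sub_quorum_coloring_leaves sub_quorum_coloring_le[OF _ assms] in auto)

theorem corollary19:
  fixes m n :: nat
  assumes "m \<ge> 1" and "n \<ge> 3"
  shows "\<psi>\<^sub>s\<^sub>q (corona (path_graph m) (edgeless_graph n)) = \<beta>\<^sub>2 (corona (path_graph m) (edgeless_graph n))
    \<and> \<beta>\<^sub>2 (corona (path_graph m) (edgeless_graph n)) = m * n"
  using assms by (simp add: sub_quorum_number_caterpillar two_independence_number_caterpillar)

end
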